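(* $$\sum_{\pi\in\mathcal{DS}^3}x^{|\pi_o|}y^{|\pi_e|}s^{o_1(\pi)}t^{o_2(\pi)}u^{e_1(\pi)}v^{e_2(\pi)}=\frac{(-sx-tx^2,\,-ux^3y-vx^3y^2;\,x^3y^3)_\infty}{(x^3;x^3y^3)_\infty}.$$
   Context: $\mathcal{DS}^3$ is the set of partitions into distinct parts in which, for no integer $l\ge0$, both $3l+1$ and $3l+2$ are parts. For a partition $\pi=(\pi_1>\pi_2>\cdots)$, $|\pi_o|$ (resp. $|\pi_e|$) is the sum of the odd-indexed parts $\pi_1,\pi_3,\dots$ (resp. even-indexed parts $\pi_2,\pi_4,\dots$); for $i=1,2$, $o_i(\pi)$ (resp. $e_i(\pi)$) is the number of odd-indexed (resp. even-indexed) parts that are $\equiv i\pmod 3$. $(a,b;q)_\infty=\prod_{i\ge1}(1-aq^{i-1})(1-bq^{i-1})$. *)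

theory Defs
  imports "HOL-Analysis.Analysis"
begin

text \<open>A partition is the strictly decreasing list of its (positive) parts.\<close>

definition DS3 :: "nat list set" where
  "DS3 = {\<pi>. sorted_wrt (>) \<pi> \<and> 0 \<notin> set \<pi> \<and>
              (\<forall>l. \<not> (3 * l + 1 \<in> set \<pi> \<and> 3 * l + 2 \<in> set \<pi>))}"

text \<open>Parts are indexed from 1 on paper but lists from 0, so the odd-indexed parts sit at
  the even list positions.\<close>

definition odd_indexed :: "nat list \<Rightarrow> nat list" where
  "odd_indexed \<pi> = nths \<pi> {i. even i}"

definition even_indexed :: "nat list \<Rightarrow> nat list" where
  "even_indexed \<pi> = nths \<pi> {i. odd i}"

definition odd_sum :: "nat list \<Rightarrow> nat" where
  "odd_sum \<pi> = sum_list (odd_indexed \<pi>)"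

definition even_sum :: "nat list \<Rightarrow> nat" where
  "even_sum \<pi> = sum_list (even_indexed \<pi>)"

definition odd_count :: "nat \<Rightarrow> nat list \<Rightarrow> nat" where
  "odd_count i \<pi> = length (filter (\<lambda>p. p mod 3 = i) (odd_indexed \<pi>))"

definition even_count :: "nat \<Rightarrow> nat list \<Rightarrow> nat" where
  "even_count i \<pi> = length (filter (\<lambda>p. p mod 3 = i) (even_indexed \<pi>))"

text \<open>The infinite q-Pochhammer symbols \<open>(a;q)\<close> and \<open>(a,b;q)\<close>; the products start at
  exponent 0, and they converge for \<open>norm q < 1\<close>.\<close>

definition qpoch_inf :: "complex \<Rightarrow> complex \<Rightarrow> complex" where
  "qpoch_inf a q = (\<Prod>i. 1 - a * q ^ i)"

definition qpoch2_inf :: "complex \<Rightarrow> complex \<Rightarrow> complex \<Rightarrow> complex" where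
  "qpoch2_inf a b q = (\<Prod>i. (1 - a * q ^ i) * (1 - b * q ^ i))"

end

theory Submission
  imports Defs
begin

text \<open>
  Put \<open>a = s x + t x\<^sup>2\<close>, \<open>b = u x\<^sup>3 y + v x\<^sup>3 y\<^sup>2\<close>, \<open>X = x\<^sup>3\<close>, \<open>q = x\<^sup>3 y\<^sup>3\<close>. Let \<open>A N\<close> be
  the generating function of the partitions with parts at most \<open>3 N\<close>, and \<open>B N\<close> the one
  with odd and even positions exchanged, times \<open>X\<^sup>N\<close>. Splitting off the parts among
  \<open>3 N + 1, 3 N + 2, 3 N + 3\<close> gives a linear system for \<open>(A, B)\<close>, and elimination of \<open>B\<close>
  gives a three-term recurrence for \<open>A\<close>. It says that
  \<open>\<Phi> z = (\<Sum>N. A N / (q;q)\<^sub>N * z ^ N)\<close> satisfies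
  \<open>(1 - z) (1 - X z) \<Phi> z = (1 + a z) (1 + b z) \<Phi> (q z)\<close>. The limit of \<open>A N / (q;q)\<^sub>N\<close> is the
  value of \<open>(1 - z) \<Phi> z\<close> at \<open>z = 1\<close>, and iterating the functional equation turns it into the
  product. Absolute convergence follows from the same linear system, applied to the norms of
  the variables.
\<close>

section \<open>The q-Pochhammer symbol\<close>

lemma convergent_prod_geometric:
  fixes a q :: complex
  assumes "norm q < 1"
  shows "convergent_prod (\<lambda>i. 1 - a * q ^ i)"
proof -
  have "summable (\<lambda>i. norm a * norm q ^ i)"
    using assms by (intro summable_mult summable_geometric) auto
  then have "abs_convergent_prod (\<lambda>i. 1 - a * q ^ i)"
    by (intro summable_imp_abs_convergent_prod) (simp add: norm_mult norm_power)
  then show ?thesis by (rule abs_convergent_prod_imp_convergent_prod)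
qed

lemma qpoch_inf_LIMSEQ:
  assumes "norm q < 1"
  shows "(\<lambda>n. \<Prod>i<n. 1 - a * q ^ i) \<longlonglongrightarrow> qpoch_inf a q"
  unfolding qpoch_inf_def
  using convergent_prod_LIMSEQ[OF convergent_prod_geometric[OF assms, of a]]
  by (subst LIMSEQ_lessThan_iff_atMost)

lemma qpoch_inf_nonzero:
  assumes "norm q < 1" "norm a < 1"
  shows "qpoch_inf a q \<noteq> 0"
  unfolding qpoch_inf_def
proof (rule prodinf_nonzero[OF convergent_prod_geometric[OF assms(1)]])
  fix i
  have "norm (a * q ^ i) \<le> norm a * 1"
    unfolding norm_mult norm_power using assms by (intro mult_left_mono power_le_one) auto
  then show "1 - a * q ^ i \<noteq> 0" using assms(2) by auto
qed

lemma qpoch2_inf_eq: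
  assumes "norm q < 1"
  shows "qpoch2_inf a b q = qpoch_inf a q * qpoch_inf b q"
  unfolding qpoch2_inf_def qpoch_inf_def
  by (rule prodinf_mult[symmetric]) (simp_all add: convergent_prod_geometric[OF assms])

section \<open>The linear system and its limit\<close>

text \<open>The relation for \<open>A\<close> expresses \<open>(X + a) * B N\<close> through
  \<open>A\<close>, so \<open>B\<close> is eliminated without dividing by \<open>X + a\<close>. The
  factor \<open>1 - q ^ Suc N\<close> that appears is absorbed later, when \<open>A N\<close> is
  divided by \<open>(q;q)\<^sub>N\<close>.\<close>

lemma three_term_recurrence:
  fixes a b X q :: "'a::comm_ring_1"
  assumes A: "\<And>N. A (Suc N) = (1 + b * q ^ N) * A N + (X + a) * B N"
    and B: "\<And>N. B (Suc N) = q ^ N * (q + b) * A N + (X + a * q ^ Suc N) * B N"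
  shows "A (Suc (Suc N)) = (1 + X + (a + b) * q ^ Suc N) * A (Suc N)
           - (1 - q ^ Suc N) * (X - a * b * q ^ N) * A N"
proof -
  have XB: "(X + a) * B N = A (Suc N) - (1 + b * q ^ N) * A N" by (simp add: A)
  have "A (Suc (Suc N)) = (1 + b * q ^ Suc N) * A (Suc N) + (X + a) * B (Suc N)" by (rule A)
  also have "(X + a) * B (Suc N) = (X + a) * (q ^ N * (q + b)) * A N
      + (X + a * q ^ Suc N) * ((X + a) * B N)"
    by (simp add: B algebra_simps)
  finally show ?thesis unfolding XB by (simp add: algebra_simps)
qed

lemma summable_powser_convergent:
  fixes c :: "nat \<Rightarrow> complex"
  assumes "c \<longlonglongrightarrow> L" and "norm w < 1"
  shows "summable (\<lambda>n. c n * w ^ n)"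
proof -
  obtain K where K: "\<And>n. norm (c n) \<le> K"
    using convergent_imp_Bseq[OF convergentI[OF assms(1)]] by (auto simp: Bseq_def)
  show ?thesis
  proof (rule summable_comparison_test')
    show "summable (\<lambda>n. K * norm w ^ n)"
      using assms(2) by (intro summable_mult summable_geometric) auto
    show "norm (c n * w ^ n) \<le> K * norm w ^ n" for n
      using K by (simp add: norm_mult norm_power mult_right_mono)
  qed
qed

text \<open>Here \<open>c N\<close> stands for \<open>A N / (q;q)\<^sub>N\<close>; the second identity is what remains of the
  functional equation of \<open>\<Sum>N. c N * z ^ N\<close> at \<open>z = 1\<close> after removing the pole.\<close>

lemma functional_equations:
  fixes a b X q L :: complex and c :: "nat \<Rightarrow> complex"
  assumes q: "norm q < 1"
    and c: "c \<longlonglongrightarrow> L"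
    and c1: "c 1 * (1 - q) = (1 + X + (a + b)) * c 0"
    and rec: "\<And>N. c (Suc (Suc N)) * (1 - q ^ Suc (Suc N)) =
        (1 + X + (a + b) * q ^ Suc N) * c (Suc N) - (X - a * b * q ^ N) * c N"
  shows "norm z < 1 \<Longrightarrow> (1 - z) * (1 - X * z) * (\<Sum>N. c N * z ^ N) =
           (1 + a * z) * (1 + b * z) * (\<Sum>N. c N * (z * q) ^ N)"
    and "L * (1 - X) = (1 + a) * (1 + b) * (\<Sum>N. c N * q ^ N)"
proof -
  define S where "S = (\<lambda>z n. \<Sum>N<n. c N * z ^ N)"
  have S: "S w \<longlonglongrightarrow> (\<Sum>N. c N * w ^ N)" if "norm w < 1" for w
    unfolding S_def by (rule summable_LIMSEQ[OF summable_powser_convergent[OF c that]])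
  \<comment> \<open>The staggered lengths truncate every term below degree \<open>n + 2\<close>, so
    comparing coefficients leaves no remainder. Being polynomial, the identity is also available at
    \<open>z = 1\<close>, outside the open unit disc.\<close>
  have partial: "S z (n + 2) - (1 + X) * z * S z (n + 1) + X * z\<^sup>2 * S z n =
      S (z * q) (n + 2) + (a + b) * z * S (z * q) (n + 1) + a * b * z\<^sup>2 * S (z * q) n" for z n
  proof (induction n)
    case 0
    have "c 1 * z = c 1 * (1 - q) * z + c 1 * z * q" by (simp add: algebra_simps)
    then show ?case unfolding c1 by (simp add: S_def algebra_simps)
  next
    case (Suc n)
    let ?d = "\<lambda>z w. c (n + 2) * w ^ (n + 2) + (a + b) * z * (c (n + 1) * w ^ (n + 1)) +
        a * b * z\<^sup>2 * (c n * w ^ n)"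
    let ?e = "c (n + 2) * z ^ (n + 2) - (1 + X) * z * (c (n + 1) * z ^ (n + 1)) +
        X * z\<^sup>2 * (c n * z ^ n)"
    have S_Suc: "S w (Suc n) = S w n + c n * w ^ n"
      "S w (Suc n + 1) = S w (n + 1) + c (n + 1) * w ^ (n + 1)"
      "S w (Suc n + 2) = S w (n + 2) + c (n + 2) * w ^ (n + 2)" for w
      by (simp_all add: S_def)
    have "c (n + 2) * z ^ (n + 2) =
        c (n + 2) * (1 - q ^ (n + 2)) * z ^ (n + 2) + c (n + 2) * (z * q) ^ (n + 2)"
      by (simp add: power_mult_distrib algebra_simps)
    also have "c (n + 2) * (1 - q ^ (n + 2)) =
        (1 + X + (a + b) * q ^ (n + 1)) * c (n + 1) - (X - a * b * q ^ n) * c n"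
      using rec[of n] by simp
    finally have "?e = ?d z (z * q)"
      by (simp add: power_mult_distrib power2_eq_square algebra_simps)
    then have "(S z (n + 2) - (1 + X) * z * S z (n + 1) + X * z\<^sup>2 * S z n) + ?e =
        (S (z * q) (n + 2) + (a + b) * z * S (z * q) (n + 1) + a * b * z\<^sup>2 * S (z * q) n)
          + ?d z (z * q)"
      unfolding Suc by (rule arg_cong)
    then show ?case unfolding S_Suc by (simp only: algebra_simps)
  qed
  have R: "(\<lambda>n. S (z * q) (n + 2) + (a + b) * z * S (z * q) (n + 1) + a * b * z\<^sup>2 * S (z * q) n)
      \<longlonglongrightarrow> (1 + a * z) * (1 + b * z) * (\<Sum>N. c N * (z * q) ^ N)" (is "?r z \<longlonglongrightarrow> ?R z")
    if "norm (z * q) < 1" for z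
  proof -
    let ?f = "\<Sum>N. c N * (z * q) ^ N"
    have "?r z \<longlonglongrightarrow> ?f + (a + b) * z * ?f + a * b * z\<^sup>2 * ?f"
      by (intro tendsto_intros LIMSEQ_ignore_initial_segment S that)
    then show ?thesis by (simp add: power2_eq_square algebra_simps)
  qed
  show "(1 - z) * (1 - X * z) * (\<Sum>N. c N * z ^ N) =
           (1 + a * z) * (1 + b * z) * (\<Sum>N. c N * (z * q) ^ N)" if z: "norm z < 1"
  proof -
    let ?f = "\<Sum>N. c N * z ^ N"
    have "norm z * norm q \<le> norm z * 1" using q by (intro mult_left_mono) auto
    then have zq: "norm (z * q) < 1" using z by (simp add: norm_mult)
    have "(\<lambda>n. S z (n + 2) - (1 + X) * z * S z (n + 1) + X * z\<^sup>2 * S z n)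
        \<longlonglongrightarrow> ?f - (1 + X) * z * ?f + X * z\<^sup>2 * ?f"
      by (intro tendsto_intros LIMSEQ_ignore_initial_segment S z)
    then have "?f - (1 + X) * z * ?f + X * z\<^sup>2 * ?f =
        (1 + a * z) * (1 + b * z) * (\<Sum>N. c N * (z * q) ^ N)"
      unfolding partial using R[OF zq] by (rule LIMSEQ_unique)
    then show ?thesis by (simp add: power2_eq_square algebra_simps)
  qed
  \<comment> \<open>At \<open>z = 1\<close> the left side telescopes, so it has a limit even where
    the series itself diverges.\<close>
  have "S 1 (n + 2) - (1 + X) * 1 * S 1 (n + 1) + X * 1\<^sup>2 * S 1 n = c (n + 1) - X * c n" for n
    by (simp add: S_def algebra_simps)
  then have "(\<lambda>n. c (n + 1) - X * c n) \<longlonglongrightarrow> (1 + a) * (1 + b) * (\<Sum>N. c N * q ^ N)"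
    using R[of 1] q unfolding partial by simp
  moreover have "(\<lambda>n. c (n + 1) - X * c n) \<longlonglongrightarrow> L - X * L"
    by (intro tendsto_intros LIMSEQ_ignore_initial_segment c)
  ultimately show "L * (1 - X) = (1 + a) * (1 + b) * (\<Sum>N. c N * q ^ N)"
    using LIMSEQ_unique by (fastforce simp: algebra_simps)
qed

text \<open>Each use of a functional equation splits off one factor of every product and moves the
  argument of the series from \<open>q ^ i\<close> to \<open>q ^ Suc i\<close>; in the limit only
  the constant term 1 of the series is left.\<close>

lemma limit_of_recurrence:
  fixes a b X q l :: complex and A B :: "nat \<Rightarrow> complex"
  assumes q: "norm q < 1" and X: "norm X < 1"
    and A0: "A 0 = 1" and B0: "B 0 = 1"
    and A: "\<And>N. A (Suc N) = (1 + b * q ^ N) * A N + (X + a) * B N"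
    and B: "\<And>N. B (Suc N) = q ^ N * (q + b) * A N + (X + a * q ^ Suc N) * B N"
    and l: "A \<longlonglongrightarrow> l"
  shows "l = qpoch2_inf (- a) (- b) q / qpoch_inf X q"
proof -
  define p where "p = (\<lambda>n. \<Prod>i<n. 1 - q * q ^ i)"
  define P where "P = qpoch_inf q q"
  define c where "c = (\<lambda>N. A N / p N)"
  define F where "F = (\<lambda>z. \<Sum>N. c N * z ^ N)"
  have q1: "q ^ Suc i \<noteq> 1" for i
  proof
    assume "q ^ Suc i = 1"
    then have "norm q ^ Suc i = 1" by (metis norm_one norm_power)
    moreover have "norm q ^ Suc i < 1" using q by (simp add: power_less_one_iff del: power_Suc)
    ultimately show False by simp
  qed
  have p0: "p n \<noteq> 0" for n using q1 by (auto simp: p_def simp flip: power_Suc)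
  have pSuc: "p (Suc n) = p n * (1 - q ^ Suc n)" for n by (simp add: p_def)
  have P0: "P \<noteq> 0" unfolding P_def using q q by (rule qpoch_inf_nonzero)
  have p: "p \<longlonglongrightarrow> P" unfolding p_def P_def by (rule qpoch_inf_LIMSEQ[OF q])
  have c: "c \<longlonglongrightarrow> l / P" unfolding c_def by (intro tendsto_divide l p P0)
  have c0: "c 0 = 1" by (simp add: c_def p_def A0)
  have c1: "c 1 * (1 - q) = (1 + X + (a + b)) * c 0"
    using p0[of 1] by (simp add: c_def p_def A A0 B0)
  have rec: "c (Suc (Suc N)) * (1 - q ^ Suc (Suc N)) =
        (1 + X + (a + b) * q ^ Suc N) * c (Suc N) - (X - a * b * q ^ N) * c N" for N
  proof -
    have "c (Suc (Suc N)) * (1 - q ^ Suc (Suc N)) = A (Suc (Suc N)) / p (Suc N)"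
      using q1[of "Suc N"] p0[of "Suc N"] by (simp add: c_def pSuc[of "Suc N"])
    moreover have "c N = (1 - q ^ Suc N) * A N / p (Suc N)"
      using q1[of N] p0[of N] by (simp add: c_def pSuc[of N])
    ultimately show ?thesis
      unfolding three_term_recurrence[of A b q X a B, OF A B]
      by (simp add: c_def diff_divide_distrib mult.assoc)
  qed
  note fe = functional_equations[OF q c c1 rec]
  \<comment> \<open>The factors with \<open>i = 0\<close> come from the equation at
    \<open>z = 1\<close>, the later ones from the equation at \<open>z = q ^ i\<close>, whose factor
    \<open>1 - q ^ i\<close> goes into \<open>p n\<close>.\<close>
  have iter: "l / P * (\<Prod>i<Suc n. 1 - X * q ^ i) * p n =
      (\<Prod>i<Suc n. 1 - (- a) * q ^ i) * (\<Prod>i<Suc n. 1 - (- b) * q ^ i) * F (q ^ Suc n)" for n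
  proof (induction n)
    case 0
    show ?case using fe(2) by (simp add: F_def p_def)
  next
    case (Suc n)
    have "norm (q ^ Suc n) < 1" unfolding norm_power using q by (simp add: power_less_one_iff del: power_Suc)
    then have fe_n: "(1 - q ^ Suc n) * (1 - X * q ^ Suc n) * F (q ^ Suc n) =
        (1 - (- a) * q ^ Suc n) * (1 - (- b) * q ^ Suc n) * F (q ^ Suc (Suc n))"
      using fe(1)[of "q ^ Suc n"] by (simp add: F_def mult.commute)
    have "m * (x * d) * (r * e) = (y * g) * (w * h) * f'"
      if "e * d * f = g * h * f'" "m * x * r = y * w * f" for m x d r e y g w h f f' :: complex
      using that by algebra
    then show ?case
      unfolding pSuc prod.lessThan_Suc[of _ "Suc n"] using fe_n Suc .
  qed
  have F: "(\<lambda>n. F (q ^ Suc n)) \<longlonglongrightarrow> 1"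
  proof -
    \<comment> \<open>Any nonzero point of the unit disc would do in place of
      \<open>1 / 2\<close>.\<close>
    have "summable (\<lambda>n. c n * (1 / 2) ^ n)"
      by (rule summable_powser_convergent[OF c]) (simp add: norm_divide)
    then have "isCont F 0" unfolding F_def by (rule isCont_powser) simp
    moreover have "(\<lambda>n. q ^ Suc n) \<longlonglongrightarrow> 0"
      by (rule LIMSEQ_Suc[OF LIMSEQ_power_zero[OF q]])
    ultimately have "(\<lambda>n. F (q ^ Suc n)) \<longlonglongrightarrow> F 0" by (rule isCont_tendsto_compose)
    then show ?thesis by (simp add: F_def c0)
  qed
  have "(\<lambda>n. l / P * (\<Prod>i<Suc n. 1 - X * q ^ i) * p n) \<longlonglongrightarrow> l / P * qpoch_inf X q * P"
    by (intro tendsto_intros p LIMSEQ_Suc qpoch_inf_LIMSEQ q)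
  moreover have "(\<lambda>n. l / P * (\<Prod>i<Suc n. 1 - X * q ^ i) * p n) \<longlonglongrightarrow>
      qpoch_inf (- a) q * qpoch_inf (- b) q * 1"
    unfolding iter by (intro tendsto_intros F LIMSEQ_Suc qpoch_inf_LIMSEQ q)
  ultimately have "l / P * qpoch_inf X q * P = qpoch_inf (- a) q * qpoch_inf (- b) q * 1"
    by (rule LIMSEQ_unique)
  then show ?thesis
    using P0 qpoch_inf_nonzero[OF q X] by (simp add: qpoch2_inf_eq[OF q] field_simps)
qed

text \<open>Eventually \<open>B\<close> is contracted by a factor below \<open>\<theta> < 1\<close>,
  apart from a contribution of \<open>A\<close> of order \<open>q ^ N\<close>. Hence
  \<open>A N + \<kappa> * B N\<close> grows by a factor of at most \<open>1 + C * q ^ N\<close>, and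
  the product of these factors is bounded.\<close>

lemma nonneg_recurrence_bounded:
  fixes a b X q :: real and A B :: "nat \<Rightarrow> real"
  assumes nonneg: "0 \<le> a" "0 \<le> b" "0 \<le> X" "0 \<le> q" and less_1: "X < 1" "q < 1"
    and A0: "0 \<le> A 0" and B0: "0 \<le> B 0"
    and A: "\<And>N. A (Suc N) = (1 + b * q ^ N) * A N + (X + a) * B N"
    and B: "\<And>N. B (Suc N) = q ^ N * (q + b) * A N + (X + a * q ^ Suc N) * B N"
  shows "\<exists>K. \<forall>N. A N \<le> K"
proof -
  have pos: "0 \<le> A N \<and> 0 \<le> B N" for N
    by (induction N) (use nonneg A0 B0 in \<open>auto simp: A B\<close>)
  define \<theta> where "\<theta> = (X + 1) / 2"
  have \<theta>: "X < \<theta>" "\<theta> < 1" using less_1 by (auto simp: \<theta>_def)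
  \<comment> \<open>With this \<open>\<kappa>\<close>, what \<open>B N\<close> adds to
    \<open>A\<close> is balanced by the loss \<open>\<kappa> * (1 - \<theta>) * B N\<close>.\<close>
  define \<kappa> where "\<kappa> = (X + a) / (1 - \<theta>)"
  have \<kappa>: "X + a = \<kappa> * (1 - \<theta>)" "0 \<le> \<kappa>" using \<theta> nonneg by (auto simp: \<kappa>_def)
  define C where "C = b + \<kappa> * (q + b)"
  have C: "0 \<le> C" using nonneg \<kappa> by (auto simp: C_def)
  define T where "T = (\<lambda>N. A N + \<kappa> * B N)"
  have T0: "0 \<le> T N" for N using pos \<kappa> by (simp add: T_def)
  have "(\<lambda>N. X + a * q ^ Suc N) \<longlonglongrightarrow> X + a * 0"
    using nonneg less_1 by (intro tendsto_intros LIMSEQ_Suc LIMSEQ_power_zero) auto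
  then have "\<forall>\<^sub>F N in sequentially. X + a * q ^ Suc N < \<theta>"
    using \<theta> by (intro order_tendstoD) auto
  then obtain M where M: "\<And>N. N \<ge> M \<Longrightarrow> X + a * q ^ Suc N < \<theta>"
    by (auto simp: eventually_sequentially)
  have step: "T (Suc N) \<le> (1 + C * q ^ N) * T N" if "N \<ge> M" for N
  proof -
    have "T (Suc N) = (1 + C * q ^ N) * A N + \<kappa> * ((1 - \<theta>) + (X + a * q ^ Suc N)) * B N"
      unfolding T_def A B C_def \<kappa>(1) by (simp add: algebra_simps)
    also have "\<dots> \<le> (1 + C * q ^ N) * A N + \<kappa> * (1 + C * q ^ N) * B N"
    proof -
      have "0 \<le> C * q ^ N" using C nonneg by simp
      then have "(1 - \<theta>) + (X + a * q ^ Suc N) \<le> 1 + C * q ^ N" using M[OF that] by linarith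
      then show ?thesis using pos[of N] \<kappa>(2) by (intro add_left_mono mult_right_mono mult_left_mono) auto
    qed
    finally show ?thesis by (simp add: T_def algebra_simps)
  qed
  have T_le: "T (M + n) \<le> T M * exp (C * (\<Sum>i<n. q ^ i))" for n
  proof (induction n)
    case (Suc n)
    have "q ^ (M + n) \<le> q ^ n" using nonneg less_1 by (intro power_decreasing) auto
    then have "1 + C * q ^ (M + n) \<le> 1 + C * q ^ n" using C by (simp add: mult_left_mono)
    also have "\<dots> \<le> exp (C * q ^ n)" by (rule exp_ge_add_one_self)
    finally have "(1 + C * q ^ (M + n)) * T (M + n) \<le>
        exp (C * q ^ n) * (T M * exp (C * (\<Sum>i<n. q ^ i)))"
      using Suc T0 by (intro mult_mono) auto
    then show ?case using step[of "M + n"] by (simp add: distrib_left exp_add mult_ac)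
  qed simp
  have geo: "(\<Sum>i<n. q ^ i) \<le> 1 / (1 - q)" for n
    using sum_le_suminf[of "\<lambda>i. q ^ i" "{..<n}"] nonneg less_1 by (simp add: suminf_geometric)
  have "A N \<le> T N" for N using pos \<kappa> by (simp add: T_def)
  moreover have "T N \<le> T M * exp (C * (1 / (1 - q)))" if "N \<ge> M" for N
  proof -
    have "exp (C * (\<Sum>i<N - M. q ^ i)) \<le> exp (C * (1 / (1 - q)))"
      using geo C by (simp add: mult_left_mono del: times_divide_eq_right)
    then have "T M * exp (C * (\<Sum>i<N - M. q ^ i)) \<le> T M * exp (C * (1 / (1 - q)))"
      using T0 by (rule mult_left_mono)
    then show ?thesis using T_le[of "N - M"] that by simp
  qed
  ultimately have "A N \<le> T M * exp (C * (1 / (1 - q)))" if "N \<ge> M" for N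
    using that order_trans by blast
  \<comment> \<open>These are the indices before the contraction sets in.\<close>
  moreover have "A N \<le> Max (A ` {..M})" if "N \<le> M" for N using that by simp
  ultimately have "A N \<le> max (T M * exp (C * (1 / (1 - q)))) (Max (A ` {..M}))" for N
    by (meson le_max_iff_disj nle_le)
  then show ?thesis by blast
qed

section \<open>Partitions with bounded parts\<close>

definition DS3_upto :: "nat \<Rightarrow> nat list set" where
  "DS3_upto k = {\<pi> \<in> DS3. \<forall>p\<in>set \<pi>. p \<le> k}"

text \<open>The general scalar type covers both the complex weights and the real weights of their
  norms.\<close>

definition wt :: "'a::comm_semiring_1 \<Rightarrow> 'a \<Rightarrow> 'a \<Rightarrow> 'a \<Rightarrow> 'a \<Rightarrow> 'a \<Rightarrow> nat list \<Rightarrow> 'a" where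
  "wt x y s t u v \<pi> = x ^ odd_sum \<pi> * y ^ even_sum \<pi> *
     s ^ odd_count 1 \<pi> * t ^ odd_count 2 \<pi> * u ^ even_count 1 \<pi> * v ^ even_count 2 \<pi>"

lemma odd_indexed_Cons: "odd_indexed (p # \<pi>) = p # even_indexed \<pi>"
  by (simp add: odd_indexed_def even_indexed_def nths_Cons)

lemma even_indexed_Cons: "even_indexed (p # \<pi>) = odd_indexed \<pi>"
  by (simp add: odd_indexed_def even_indexed_def nths_Cons)

lemma wt_Nil: "wt x y s t u v [] = 1"
  by (simp add: wt_def odd_sum_def even_sum_def odd_count_def even_count_def
      odd_indexed_def even_indexed_def)

text \<open>A new largest part shifts all positions by one, so the variables for odd and even
  positions trade places.\<close>

lemma wt_Cons:
  "wt x y s t u v (p # \<pi>) =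
     x ^ p * (if p mod 3 = 1 then s else if p mod 3 = 2 then t else 1) * wt y x u v s t \<pi>"
  by (simp add: wt_def odd_sum_def even_sum_def odd_count_def even_count_def
      odd_indexed_Cons even_indexed_Cons power_add mult_ac)

lemma norm_wt:
  fixes x :: "'a::real_normed_field"
  shows "norm (wt x y s t u v \<pi>) = wt (norm x) (norm y) (norm s) (norm t) (norm u) (norm v) \<pi>"
  by (simp add: wt_def norm_mult norm_power)

lemma DS3_upto_0: "DS3_upto 0 = {[]}"
proof -
  have "\<pi> = []" if "\<pi> \<in> DS3_upto 0" for \<pi>
    using that by (cases \<pi>) (auto simp: DS3_upto_def DS3_def)
  then show ?thesis by (auto simp: DS3_upto_def DS3_def)
qed

lemma DS3_upto_mono: "j \<le> k \<Longrightarrow> DS3_upto j \<subseteq> DS3_upto k"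
  by (auto simp: DS3_upto_def)

text \<open>A largest part \<open>3 * l + 2\<close> forbids \<open>3 * l + 1\<close>, which lowers
  the bound on the rest to \<open>3 * l\<close>. The other residues forbid no smaller part.\<close>

lemma Cons_in_DS3_upto:
  "p # \<pi> \<in> DS3_upto (Suc k) \<and> p = Suc k \<longleftrightarrow>
     p = Suc k \<and> \<pi> \<in> DS3_upto (if Suc k mod 3 = 2 then k - 1 else k)"
proof (cases "Suc k mod 3 = 2")
  case True
  define l where "l = k div 3"
  have k: "k = 3 * l + 1" using True unfolding l_def by presburger
  have "3 * m + 1 = 3 * l + 2 \<longleftrightarrow> False" "3 * m + 2 = 3 * l + 2 \<longleftrightarrow> m = l" 
    "m \<noteq> l \<or> 3 * m + 1 = 3 * l + 1" for m by presburger+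
  moreover have "p \<le> 3 * l \<longleftrightarrow> p < 3 * l + 2 \<and> p \<noteq> 3 * l + 1" for p by presburger
  ultimately show ?thesis
    unfolding DS3_upto_def DS3_def k using True[unfolded k]
    by (auto simp: less_imp_le)
next
  case False
  have *: "3 * m + 2 \<noteq> Suc k" "3 * m + 1 = Suc k \<Longrightarrow> p \<le> k \<Longrightarrow> p \<noteq> 3 * m + 2" for m p
    using False by presburger+
  show ?thesis
    unfolding DS3_upto_def DS3_def using False *
    by (auto simp: less_Suc_eq_le)
qed

lemma DS3_upto_Suc:
  "DS3_upto (Suc k) =
     DS3_upto k \<union> (#) (Suc k) ` DS3_upto (if Suc k mod 3 = 2 then k - 1 else k)"
  (is "_ = _ \<union> _ ` ?E")
proof (intro equalityI subsetI)
  fix \<pi> assume \<pi>: "\<pi> \<in> DS3_upto (Suc k)"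
  show "\<pi> \<in> DS3_upto k \<union> (#) (Suc k) ` ?E"
  proof (cases \<pi>)
    case Nil
    then show ?thesis by (simp add: DS3_upto_def DS3_def)
  next
    case (Cons p \<rho>)
    show ?thesis
    proof (cases "p = Suc k")
      case True
      then show ?thesis using Cons_in_DS3_upto[of p \<rho> k] \<pi> Cons by blast
    next
      case False
      then have "\<pi> \<in> DS3_upto k" using \<pi> Cons by (auto simp: DS3_upto_def DS3_def)
      then show ?thesis ..
    qed
  qed
next
  fix \<pi> assume "\<pi> \<in> DS3_upto k \<union> (#) (Suc k) ` ?E"
  then show "\<pi> \<in> DS3_upto (Suc k)"
    using DS3_upto_mono[of k "Suc k"] Cons_in_DS3_upto[of "Suc k" _ k] by auto
qed

lemma finite_DS3_upto: "finite (DS3_upto k)"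
proof (induction k rule: less_induct)
  case (less k)
  show ?case
  proof (cases k)
    case 0
    then show ?thesis by (simp add: DS3_upto_0)
  next
    case (Suc j)
    then show ?thesis using less[of j] less[of "j - 1"] by (simp add: DS3_upto_Suc)
  qed
qed

lemma sum_wt_Suc:
  "(\<Sum>\<pi>\<in>DS3_upto (Suc k). wt x y s t u v \<pi>) =
     (\<Sum>\<pi>\<in>DS3_upto k. wt x y s t u v \<pi>) +
     x ^ Suc k * (if Suc k mod 3 = 1 then s else if Suc k mod 3 = 2 then t else 1) *
     (\<Sum>\<pi>\<in>DS3_upto (if Suc k mod 3 = 2 then k - 1 else k). wt y x u v s t \<pi>)"
proof -
  let ?E = "DS3_upto (if Suc k mod 3 = 2 then k - 1 else k)"
  have disj: "DS3_upto k \<inter> (#) (Suc k) ` ?E = {}"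
    by (auto simp: DS3_upto_def)
  have "(\<Sum>\<pi>\<in>(#) (Suc k) ` ?E. wt x y s t u v \<pi>) =
      (\<Sum>\<pi>\<in>?E. wt x y s t u v (Suc k # \<pi>))"
    by (subst sum.reindex) (auto simp: o_def)
  then show ?thesis
    unfolding DS3_upto_Suc[of k]
    by (subst sum.union_disjoint[OF finite_DS3_upto _ disj])
      (simp_all only: finite_imageI finite_DS3_upto wt_Cons sum_distrib_left)
qed

text \<open>At most two of the three new parts occur together, and then one of them is
  \<open>3 * N + 3\<close>. An even number of them keeps the parity of the positions below, an odd
  number flips it.\<close>

lemma sum_wt_block:
  "(\<Sum>\<pi>\<in>DS3_upto (3 * Suc N). wt x y s t u v \<pi>) =
     (1 + x ^ (3 * N + 3) * (u * y ^ (3 * N + 1) + v * y ^ (3 * N + 2))) *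
       (\<Sum>\<pi>\<in>DS3_upto (3 * N). wt x y s t u v \<pi>) +
     (s * x ^ (3 * N + 1) + t * x ^ (3 * N + 2) + x ^ (3 * N + 3)) *
       (\<Sum>\<pi>\<in>DS3_upto (3 * N). wt y x u v s t \<pi>)"
proof -
  have m: "Suc (3 * N) mod 3 = 1" "Suc (Suc (3 * N)) mod 3 = 2" "Suc (Suc (Suc (3 * N))) mod 3 = 0"
    by presburger+
  have n: "((0::nat) = 1) = False" "((0::nat) = 2) = False" "((1::nat) = 2) = False"
    "((2::nat) = 1) = False" by simp_all
  have e: "3 * Suc N = Suc (Suc (Suc (3 * N)))" "3 * N + 3 = Suc (Suc (Suc (3 * N)))"
    "3 * N + 2 = Suc (Suc (3 * N))" "3 * N + 1 = Suc (3 * N)" by simp_all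
  show ?thesis
    unfolding e
    by (simp only: sum_wt_Suc m n if_True if_False refl diff_Suc_1) (simp add: algebra_simps)
qed

section \<open>Passage from bounded parts to all of \<open>DS3\<close>\<close>

lemma finite_subset_DS3_upto:
  assumes "finite F" "F \<subseteq> DS3"
  shows "\<exists>k. F \<subseteq> DS3_upto k"
proof -
  have "finite (\<Union>(set ` F))" using assms by auto
  then obtain k where "\<forall>p\<in>\<Union>(set ` F). p \<le> k" using finite_nat_set_iff_bounded_le by meson
  then show ?thesis using assms by (auto simp: DS3_upto_def)
qed

text \<open>This turns an unordered sum over \<open>DS3\<close> into the limit of a sequence of
  finite sums.\<close>

lemma filterlim_DS3_upto: "filterlim (\<lambda>N. DS3_upto (3 * N)) (finite_subsets_at_top DS3) sequentially"
  unfolding filterlim_finite_subsets_at_top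
proof (intro allI impI)
  fix F assume F: "finite F \<and> F \<subseteq> DS3"
  then obtain k where "F \<subseteq> DS3_upto k" using finite_subset_DS3_upto by blast
  then have "F \<subseteq> DS3_upto (3 * N)" if "N \<ge> k" for N
    using that DS3_upto_mono[of k "3 * N"] by force
  then show "\<forall>\<^sub>F N in sequentially. finite (DS3_upto (3 * N)) \<and> F \<subseteq> DS3_upto (3 * N)
      \<and> DS3_upto (3 * N) \<subseteq> DS3"
    using finite_DS3_upto unfolding eventually_sequentially
    by (intro exI[of _ k]) (auto simp: DS3_upto_def)
qed

text \<open>\<open>B N\<close> is the total weight of the parts up to \<open>3 N\<close> when they are placed below an odd number
  of larger parts; the power of \<open>x\<close> makes the coefficients of the system depend on \<open>N\<close> only
  through \<open>q\<^sup>N\<close>.\<close>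

context
  fixes x y s t u v :: "'a::comm_ring_1" and A B :: "nat \<Rightarrow> 'a"
  defines "A \<equiv> \<lambda>N. \<Sum>\<pi>\<in>DS3_upto (3 * N). wt x y s t u v \<pi>"
    and "B \<equiv> \<lambda>N. x ^ (3 * N) * (\<Sum>\<pi>\<in>DS3_upto (3 * N). wt y x u v s t \<pi>)"
begin

lemma wt_recurrence_A:
  "A (Suc N) = (1 + (u * x ^ 3 * y + v * x ^ 3 * y ^ 2) * (x ^ 3 * y ^ 3) ^ N) * A N +
     (x ^ 3 + (s * x + t * x ^ 2)) * B N"
  unfolding A_def B_def sum_wt_block
  by (simp add: power_add power_mult power_mult_distrib power2_eq_square power3_eq_cube algebra_simps)

text \<open>This is the block identity with the variables exchanged, times
  \<open>x ^ (3 * N + 3)\<close>; equal powers of \<open>x ^ 3\<close> and \<open>y ^ 3\<close> pair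
  up to powers of \<open>x ^ 3 * y ^ 3\<close>.\<close>

lemma wt_recurrence_B:
  "B (Suc N) = (x ^ 3 * y ^ 3) ^ N * (x ^ 3 * y ^ 3 + (u * x ^ 3 * y + v * x ^ 3 * y ^ 2)) * A N +
     (x ^ 3 + (s * x + t * x ^ 2) * (x ^ 3 * y ^ 3) ^ Suc N) * B N"
  unfolding A_def B_def sum_wt_block
  by (simp add: power_add power_mult power_mult_distrib power2_eq_square power3_eq_cube algebra_simps)

lemma wt_recurrence_0: "A 0 = 1" "B 0 = 1"
  by (simp_all add: A_def B_def DS3_upto_0 wt_Nil)

end

text \<open>The norm of a weight is the weight of the norms, so the sums of norms obey the same
  system with nonnegative coefficients and stay bounded.\<close>

lemma abs_summable_wt:
  fixes x y s t u v :: complex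
  assumes "norm x < 1" and "norm (x * y) < 1"
  shows "(\<lambda>\<pi>. norm (wt x y s t u v \<pi>)) summable_on DS3"
proof -
  let ?w = "wt (norm x) (norm y) (norm s) (norm t) (norm u) (norm v)"
  have "norm x ^ 3 * norm y ^ 3 < 1"
    using assms(2) by (simp add: norm_mult power_less_one_iff flip: power_mult_distrib)
  moreover have "norm x ^ 3 < 1" using assms(1) by (simp add: power_less_one_iff)
  ultimately obtain K where K: "\<And>N. (\<Sum>\<pi>\<in>DS3_upto (3 * N). ?w \<pi>) \<le> K"
    using nonneg_recurrence_bounded[OF _ _ _ _ _ _ _ _ wt_recurrence_A wt_recurrence_B,
        of "norm s" "norm x" "norm t" "norm u" "norm y" "norm v"]
    by (auto simp: DS3_upto_0 wt_Nil)
  have "(\<Sum>\<pi>\<in>F. norm (wt x y s t u v \<pi>)) \<le> K" if F: "F \<subseteq> DS3" "finite F" for F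
  proof -
    obtain k where "F \<subseteq> DS3_upto k" using finite_subset_DS3_upto F by blast
    then have "F \<subseteq> DS3_upto (3 * k)" using DS3_upto_mono[of k "3 * k"] by force
    then have "(\<Sum>\<pi>\<in>F. norm (wt x y s t u v \<pi>)) \<le>
        (\<Sum>\<pi>\<in>DS3_upto (3 * k). norm (wt x y s t u v \<pi>))"
      by (intro sum_mono2 finite_DS3_upto) auto
    then show ?thesis using K[of k] by (simp add: norm_wt)
  qed
  then show ?thesis unfolding Infinite_Sum.abs_summable_iff_bdd_above by (intro bdd_aboveI[of _ K]) auto
qed

theorem theorem3p4:
  fixes x y s t u v :: complex
  assumes "norm x < 1" and "norm (x * y) < 1"
  shows "((\<lambda>\<pi>. x ^ odd_sum \<pi> * y ^ even_sum \<pi> *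
                s ^ odd_count 1 \<pi> * t ^ odd_count 2 \<pi> *
                u ^ even_count 1 \<pi> * v ^ even_count 2 \<pi>)
          has_sum
          (qpoch2_inf (- s * x - t * x ^ 2) (- u * x ^ 3 * y - v * x ^ 3 * y ^ 2) (x ^ 3 * y ^ 3)
             / qpoch_inf (x ^ 3) (x ^ 3 * y ^ 3))) DS3"
proof -
  have q: "norm (x ^ 3 * y ^ 3) < 1"
    unfolding power_mult_distrib[symmetric] norm_power
    using assms(2) by (simp add: power_less_one_iff)
  have X: "norm (x ^ 3) < 1"
    unfolding norm_power using assms(1) by (simp add: power_less_one_iff)
  \<comment> \<open>Absolute convergence provides some sum \<open>l\<close>; the exhaustion by
    bounded parts then identifies it.\<close>
  obtain l where l: "(wt x y s t u v has_sum l) DS3"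
    using abs_summable_summable[OF abs_summable_wt[OF assms]] unfolding summable_on_def by blast
  then have "(\<lambda>N. \<Sum>\<pi>\<in>DS3_upto (3 * N). wt x y s t u v \<pi>) \<longlonglongrightarrow> l"
    unfolding has_sum_def by (rule filterlim_compose[OF _ filterlim_DS3_upto])
  then have "l = qpoch2_inf (- (s * x + t * x ^ 2)) (- (u * x ^ 3 * y + v * x ^ 3 * y ^ 2))
      (x ^ 3 * y ^ 3) / qpoch_inf (x ^ 3) (x ^ 3 * y ^ 3)"
    by (rule limit_of_recurrence[OF q X wt_recurrence_0 wt_recurrence_A wt_recurrence_B])
  then show ?thesis using l by (simp add: wt_def[abs_def])
qed

end
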